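(* Let $f:\overline{\mathbb{C}_+}\to\mathbb{C}$ be a function that is holomorphic in $\mathbb{C}_+$ and suppose that for some $\alpha\ge 0$, $C>0$, $M\in\mathbb{N}$ we have $$|f(z)|\le C(1+|z|)^M e^{\alpha\,\mathrm{Im}\, z},\qquad z\in\overline{\mathbb{C}_+}.$$ Assume that $f(z)\neq 0$ for $0<\mathrm{Im}\, z<1$. Then $$\lim_{|x|\to\infty,\ x\in\mathbb{R}}\frac{\log|f(x+i/2)|}{x^2}=0.$$
   Context: $\mathbb{C}_+=\{z\in\mathbb{C}:\mathrm{Im}\, z>0\}$ is the open upper half-plane and $\overline{\mathbb{C}_+}=\{z\in\mathbb{C}:\mathrm{Im}\, z\ge 0\}$ is its closure in $\mathbb{C}$. *)

theory Defs
  imports "HOL-Complex_Analysis.Complex_Analysis"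
begin

end

theory Submission imports Defs "HOL-Real_Asymp.Real_Asymp" begin

text \<open>
  Dividing \<open>f\<close> by a constant multiple of \<open>exp (- \<i> \<alpha> z) (z + \<i>) ^ M\<close>, the logarithm of whose modulus is
  \<open>O(ln \<bar>x\<bar>)\<close> on the line \<open>Im z = 1/2\<close>, reduces the claim to a function \<open>g\<close> on the upper half-plane with
  \<open>\<bar>g\<bar> < 1\<close> and without zeros in the strip. Then \<open>h = - ln \<bar>g\<bar>\<close> is a positive superharmonic function that
  is harmonic in the strip, and \<open>h (x + \<i>/2) = o(x\<^sup>2)\<close> has to be shown.

  Suppose that \<open>h (x + \<i>/2) \<ge> \<delta> x\<^sup>2\<close> for a \<open>\<delta> > 0\<close> and arbitrarily large \<open>\<bar>x\<bar>\<close>. For each \<open>n\<close>, choose \<open>n\<close>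
  such points, all large and far apart from each other (\<open>sparse_finite_subset\<close>). By Harnack's inequality
  (\<open>harnack_ln_norm\<close>), \<open>h \<ge> \<delta> x\<^sup>2 / 3\<close> on the disc of radius \<open>1/4\<close> around each \<open>w = x + \<i>/2\<close>. Let \<open>P\<close> be
  the sum, over the chosen points, of \<open>\<delta> x\<^sup>2 / 24\<close> times the Poisson kernel \<open>(Im z - 1/2) / \<bar>z - w\<bar>\<^sup>2\<close>
  of the half-plane \<open>Im z > 1/2\<close>. It vanishes on the line \<open>Im z = 1/2\<close> away from the points and at infinity.
  On the boundary of each disc, the mutual distances keep the contribution of the other points
  to \<open>P\<close> so small that \<open>P \<le> h\<close> there. The maximum principle gives \<open>P \<le> h\<close> in the half-plane minus the discs. At \<open>3\<i>/4\<close> each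
  point contributes at least \<open>\<delta> / 192\<close> to \<open>P\<close>, since its kernel there is comparable to \<open>1 / x\<^sup>2\<close>
  (\<open>ln_norm_le_card_bound\<close>). Hence \<open>h (3\<i>/4) \<ge> n \<delta> / 192\<close> for every \<open>n\<close>,
  which is absurd because \<open>g (3\<i>/4) \<noteq> 0\<close>.
\<close>

section \<open>Harnack's inequality for the logarithm of a zero-free function\<close>

text \<open>
  This is Harnack's inequality for the positive harmonic function \<open>- ln \<bar>g\<bar>\<close>, with the constant
  \<open>(1 - 1/2) / (1 + 1/2)\<close> for the concentric disc of half the radius. It comes from the Schwarz lemma applied to a
  branch \<open>p\<close> of \<open>ln g\<close>, followed by the Cayley map from the left half-plane to the disc that sends \<open>p w\<close> to \<open>0\<close>.
\<close>

lemma harnack_ln_norm: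
  assumes "r > 0" and hol: "g holomorphic_on ball w r"
    and nz: "\<And>z. z \<in> ball w r \<Longrightarrow> g z \<noteq> 0"
    and lt1: "\<And>z. z \<in> ball w r \<Longrightarrow> norm (g z) < 1"
    and z: "norm (z - w) \<le> r / 2"
  shows "ln (norm (g z)) \<le> ln (norm (g w)) / 3"
proof -
  have "simply_connected (ball w r)"
    by (simp add: convex_imp_simply_connected)
  then obtain p where p: "p holomorphic_on ball w r" "\<And>z. z \<in> ball w r \<Longrightarrow> g z = exp (p z)"
    using simply_connected_eq_holomorphic_log[OF open_ball, of w r] hol nz by blast
  have neg: "Re (p u) < 0" if "u \<in> ball w r" for u
    using lt1[OF that] p(2)[OF that] by simp
  define a where "a = p w"
  have a: "Re a < 0" using neg[of w] \<open>r > 0\<close> by (simp add: a_def)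
  \<comment> \<open>\<open>u\<close> and \<open>a\<close> lie in the left half-plane and \<open>- cnj a\<close> is the mirror image of \<open>a\<close>.\<close>
  have closer: "norm (u - a) < norm (u + cnj a)" if "Re u < 0" for u
  proof -
    have "Re u * Re a > 0" using that a by (simp add: mult_neg_neg)
    then have "(norm (u - a))\<^sup>2 < (norm (u + cnj a))\<^sup>2"
      unfolding cmod_power2 by (simp add: power2_eq_square algebra_simps)
    then show ?thesis by (rule power2_less_imp_less) simp
  qed
  define q where "q = (\<lambda>\<zeta>. (p (w + of_real r * \<zeta>) - a) / (p (w + of_real r * \<zeta>) + cnj a))"
  have mem: "w + of_real r * \<zeta> \<in> ball w r" if "norm \<zeta> < 1" for \<zeta>
    using that \<open>r > 0\<close> by (simp add: dist_norm norm_mult)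
  have q_lt1: "norm (q \<zeta>) < 1" and den: "p (w + of_real r * \<zeta>) + cnj a \<noteq> 0"
    if "norm \<zeta> < 1" for \<zeta>
  proof -
    have "norm (p (w + of_real r * \<zeta>) - a) < norm (p (w + of_real r * \<zeta>) + cnj a)"
      by (rule closer[OF neg[OF mem[OF that]]])
    moreover from this show "p (w + of_real r * \<zeta>) + cnj a \<noteq> 0"
      by (metis norm_zero norm_not_less_zero)
    ultimately show "norm (q \<zeta>) < 1"
      unfolding q_def norm_divide by (simp add: divide_less_eq_1)
  qed
  have "p \<circ> (\<lambda>\<zeta>. w + of_real r * \<zeta>) holomorphic_on ball 0 1"
  proof (rule holomorphic_on_compose_gen[OF _ p(1)])
    show "(\<lambda>\<zeta>. w + of_real r * \<zeta>) holomorphic_on ball 0 1" by (intro holomorphic_intros)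
    show "(\<lambda>\<zeta>. w + of_real r * \<zeta>) ` ball 0 1 \<subseteq> ball w r"
      by (rule image_subsetI, rule mem) simp
  qed
  then have "(\<lambda>\<zeta>. p (w + of_real r * \<zeta>)) holomorphic_on ball 0 1"
    by (simp add: o_def)
  then have "q holomorphic_on ball 0 1"
    unfolding q_def by (intro holomorphic_intros den) simp_all
  moreover have "q 0 = 0" by (simp add: q_def a_def)
  moreover define \<zeta> where "\<zeta> = (z - w) / of_real r"
  have \<zeta>: "norm \<zeta> \<le> 1 / 2"
    using z \<open>r > 0\<close> by (simp add: \<zeta>_def norm_divide field_simps)
  moreover have "norm \<zeta> < 1" using \<zeta> by linarith
  ultimately have "norm (q \<zeta>) \<le> norm \<zeta>"
    using q_lt1 by (intro Schwarz_Lemma(1))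
  then have half: "norm (q \<zeta>) \<le> 1 / 2" using \<zeta> by linarith
  have wz: "w + of_real r * \<zeta> = z" using \<open>r > 0\<close> by (simp add: \<zeta>_def)
  have "norm (p z + cnj a) > 0" using den[of \<zeta>] \<zeta> unfolding wz by simp
  then have "norm (p z - a) \<le> norm (p z + cnj a) / 2"
    using half unfolding q_def wz norm_divide by (simp add: pos_divide_le_eq)
  then have "(norm (p z - a))\<^sup>2 \<le> (norm (p z + cnj a) / 2)\<^sup>2"
    by (intro power_mono) auto
  then have "4 * ((Re (p z) - Re a)\<^sup>2 + (Im (p z) - Im a)\<^sup>2)
      \<le> (Re (p z) + Re a)\<^sup>2 + (Im (p z) - Im a)\<^sup>2"
    by (simp add: cmod_power2 power_divide)
  then have sq: "(2 * (Re (p z) - Re a))\<^sup>2 \<le> (- Re (p z) - Re a)\<^sup>2"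
    using zero_le_power2[of "Im (p z) - Im a"]
    by (simp add: power2_eq_square algebra_simps)
  have zb: "z \<in> ball w r"
    using z \<open>r > 0\<close> by (simp add: dist_norm norm_minus_commute)
  have "2 * (Re (p z) - Re a) \<le> - Re (p z) - Re a"
    using sq by (rule power2_le_imp_le) (use neg[OF zb] a in auto)
  then have "Re (p z) \<le> Re a / 3" by simp
  moreover have "g w = exp a" using p(2)[of w] \<open>r > 0\<close> by (simp add: a_def)
  ultimately show ?thesis using p(2)[OF zb] by simp
qed

section \<open>A lower bound by Poisson kernels\<close>

lemma Re_of_real_times_ii_divide:
  "Re (of_real c * (\<i> / u)) = c * (Im u / (norm u)\<^sup>2)"
proof -
  have "Re (\<i> / u) = Im u / (norm u)\<^sup>2"
    by (simp add: Re_divide cmod_power2)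
  then show ?thesis
    by (simp only: times_complex.sel Im_complex_of_real Re_complex_of_real mult_zero_left diff_0_right)
qed

text \<open>
  Each of finitely many sparse points \<open>x + \<i>/2\<close> at which \<open>\<bar>g\<bar> \<le> exp (- \<delta> x\<^sup>2)\<close> lowers \<open>ln \<bar>g\<bar>\<close> at the
  fixed point \<open>3\<i>/4\<close> by at least \<open>\<delta> / 192\<close>. The sparseness condition applies to both orders of a pair, so
  the distance is at least half of the larger modulus.
\<close>
lemma ln_norm_le_card_bound:
  fixes A :: "real set"
  assumes hol: "g holomorphic_on {z. Im z > 0}"
    and lt1: "\<And>z. Im z > 0 \<Longrightarrow> norm (g z) < 1"
    and nz: "\<And>z. 0 < Im z \<Longrightarrow> Im z < 1 \<Longrightarrow> g z \<noteq> 0"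
    and "finite A" and "\<delta> > 0"
    and small: "\<And>x. x \<in> A \<Longrightarrow> ln (norm (g (Complex x (1/2)))) \<le> - \<delta> * x\<^sup>2"
    and big: "\<And>x. x \<in> A \<Longrightarrow> 1 \<le> x\<^sup>2" "\<And>x. x \<in> A \<Longrightarrow> real (card A) \<le> x\<^sup>2"
    and sparse: "\<And>x y. x \<in> A \<Longrightarrow> y \<in> A \<Longrightarrow> x \<noteq> y \<Longrightarrow> \<bar>x - y\<bar> \<ge> \<bar>x\<bar> / 2 + 1 / 2"
  shows "ln (norm (g (Complex 0 (3/4)))) \<le> - (\<delta> * real (card A) / 192)"
proof -
  define w where "w = (\<lambda>x. Complex x (1/2))"
  define k where "k = \<delta> / 24"
  have "k > 0" using \<open>\<delta> > 0\<close> by (simp add: k_def)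
  define E where "E = (\<lambda>z. \<Sum>x\<in>A. of_real (k * x\<^sup>2) * (\<i> / (z - w x)))"
  \<comment> \<open>The real part of \<open>E\<close> is a combination of Poisson kernels of the half-plane \<open>Im z > 1/2\<close>.\<close>
  have ReE: "Re (E z) = (\<Sum>x\<in>A. k * x\<^sup>2 * ((Im z - 1/2) / (norm (z - w x))\<^sup>2))" for z
    unfolding E_def Re_sum
    by (simp only: Re_of_real_times_ii_divide) (simp add: w_def)
  define F where "F = (\<lambda>z. g z * exp (E z))"
  have normF: "norm (F z) = norm (g z) * exp (Re (E z))" for z
    by (simp add: F_def norm_mult)
  define \<xi> where "\<xi> = Complex 0 (3/4)"
  have far_\<xi>: "norm (\<xi> - w x) > 1/4" if "x \<in> A" for x
  proof -
    have "1 \<le> \<bar>x\<bar>" using big(1)[OF that] abs_le_square_iff[of 1 x] by simp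
    then show ?thesis using abs_Re_le_cmod[of "\<xi> - w x"] by (simp add: \<xi>_def w_def)
  qed
  \<comment> \<open>Near \<open>w m\<close> the kernel at \<open>w m\<close> adds at most \<open>4 k m\<^sup>2\<close> to the exponent, and each of the fewer than \<open>m\<^sup>2\<close>
    other kernels at most \<open>k\<close>. Together this is less than the \<open>\<delta> m\<^sup>2 / 3\<close> that Harnack's inequality provides.\<close>
  have circle: "norm (F z) \<le> 1"
    if m: "m \<in> A" and z: "norm (z - w m) = 1/4" and Imz: "Im z \<ge> 1/2" for z m
  proof -
    have Im_le: "Im z - 1/2 \<le> 1/4"
      using abs_Im_le_cmod[of "z - w m"] z by (simp add: w_def)
    have Re_near: "\<bar>Re z - m\<bar> \<le> 1/4"
      using abs_Re_le_cmod[of "z - w m"] z by (simp add: w_def)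
    have "ln (norm (g z)) \<le> ln (norm (g (w m))) / 3"
    proof (rule harnack_ln_norm[of "1/2" g "w m" z])
      have *: "0 < Im u \<and> Im u < 1" if "u \<in> ball (w m) (1/2)" for u
        using abs_Im_le_cmod[of "w m - u"] that by (auto simp: dist_norm w_def)
      show "g holomorphic_on ball (w m) (1/2)"
        using hol by (rule holomorphic_on_subset) (use * in auto)
      show "g u \<noteq> 0" "norm (g u) < 1" if "u \<in> ball (w m) (1/2)" for u
        using *[OF that] nz lt1 by auto
    qed (use z in auto)
    also have "\<dots> \<le> - \<delta> * m\<^sup>2 / 3" using small[OF m] by (simp add: w_def)
    finally have g_le: "ln (norm (g z)) \<le> - \<delta> * m\<^sup>2 / 3" .
    have own: "k * m\<^sup>2 * ((Im z - 1/2) / (norm (z - w m))\<^sup>2) \<le> 4 * k * m\<^sup>2"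
    proof -
      have "(Im z - 1/2) / (norm (z - w m))\<^sup>2 \<le> 4"
        unfolding z using Im_le by (simp add: power2_eq_square)
      then have "k * m\<^sup>2 * ((Im z - 1/2) / (norm (z - w m))\<^sup>2) \<le> k * m\<^sup>2 * 4"
        using \<open>k > 0\<close> by (intro mult_left_mono) auto
      then show ?thesis by simp
    qed
    have others: "k * x\<^sup>2 * ((Im z - 1/2) / (norm (z - w x))\<^sup>2) \<le> k" if x: "x \<in> A - {m}" for x
    proof -
      have "\<bar>x - m\<bar> \<ge> \<bar>x\<bar> / 2 + 1 / 2" using sparse[of x m] x m by auto
      then have "\<bar>x\<bar> / 2 \<le> \<bar>Re z - x\<bar>" using Re_near by linarith
      also have "\<dots> \<le> norm (z - w x)" using abs_Re_le_cmod[of "z - w x"] by (simp add: w_def)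
      finally have "(\<bar>x\<bar> / 2)\<^sup>2 \<le> (norm (z - w x))\<^sup>2" by (intro power_mono) auto
      then have "x\<^sup>2 * (Im z - 1/2) \<le> (norm (z - w x))\<^sup>2"
        using mult_left_mono[OF Im_le, of "x\<^sup>2"] by (simp add: power_divide)
      moreover have "0 < (\<bar>x\<bar> / 2)\<^sup>2" using big(1)[of x] x by auto
      then have "0 < (norm (z - w x))\<^sup>2"
        using \<open>(\<bar>x\<bar> / 2)\<^sup>2 \<le> _\<close> by linarith
      ultimately have "x\<^sup>2 * ((Im z - 1/2) / (norm (z - w x))\<^sup>2) \<le> 1"
        by (simp add: divide_simps)
      then have "k * (x\<^sup>2 * ((Im z - 1/2) / (norm (z - w x))\<^sup>2)) \<le> k * 1"
        using \<open>k > 0\<close> by (intro mult_left_mono) auto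
      then show ?thesis by (simp only: mult.assoc mult_1_right)
    qed
    have "Re (E z) = k * m\<^sup>2 * ((Im z - 1/2) / (norm (z - w m))\<^sup>2)
        + (\<Sum>x\<in>A-{m}. k * x\<^sup>2 * ((Im z - 1/2) / (norm (z - w x))\<^sup>2))"
      unfolding ReE using \<open>finite A\<close> m by (rule sum.remove)
    also have "\<dots> \<le> 4 * k * m\<^sup>2 + real (card (A - {m})) * k"
      using own sum_bounded_above[of "A - {m}", OF others] by (intro add_mono) auto
    also have "\<dots> \<le> 4 * k * m\<^sup>2 + m\<^sup>2 * k"
    proof -
      have "card (A - {m}) \<le> card A" using \<open>finite A\<close> by (simp add: card_mono)
      then have "real (card (A - {m})) \<le> m\<^sup>2" using big(2)[OF m] by linarith
      then show ?thesis using \<open>k > 0\<close> by simp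
    qed
    also have "\<dots> \<le> \<delta> * m\<^sup>2 / 3" using \<open>\<delta> > 0\<close> by (simp add: k_def)
    finally have E_le: "Re (E z) \<le> \<delta> * m\<^sup>2 / 3" .
    have "g z \<noteq> 0" using nz Imz Im_le by simp
    then have "norm (F z) = exp (ln (norm (g z)) + Re (E z))" by (simp add: normF exp_add)
    also have "\<dots> \<le> 1" using g_le E_le by simp
    finally show ?thesis .
  qed
  \<comment> \<open>The region is unbounded and \<open>exp (E z)\<close> only tends to \<open>1\<close> at infinity, so the maximum principle is applied
    on a large truncation, where it gives every bound \<open>B > 1\<close>.\<close>
  have F_le: "norm (F \<xi>) \<le> B" if "B > 1" for B
  proof -
    have shift: "filterlim (\<lambda>z. z - c) at_infinity at_infinity" for c :: complex
      using tendsto_add_filterlim_at_infinity[OF tendsto_const filterlim_ident, of "- c"] by simp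
    have "(E \<longlongrightarrow> (\<Sum>x\<in>A. of_real (k * x\<^sup>2) * 0)) at_infinity"
      unfolding E_def by (intro tendsto_intros tendsto_divide_0[OF tendsto_const] shift)
    then have "((\<lambda>z. norm (exp (E z))) \<longlongrightarrow> norm (exp 0 :: complex)) at_infinity"
      by (intro tendsto_intros) simp
    then have "eventually (\<lambda>z. norm (exp (E z)) < B) at_infinity"
      using \<open>B > 1\<close> by (intro order_tendstoD(2)) auto
    then obtain R0 where R0: "\<And>z. norm z \<ge> R0 \<Longrightarrow> norm (exp (E z)) < B"
      by (auto simp: eventually_at_infinity)
    define R where "R = max R0 1"
    define S where "S = {z. Im z > 1/2} \<inter> ball 0 R \<inter> (\<Inter>x\<in>A. - cball (w x) (1/4))"
    define T where "T = {z. Im z \<ge> 1/2} \<inter> cball 0 R \<inter> (\<Inter>x\<in>A. - ball (w x) (1/4))"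
    have "open S" unfolding S_def
      using \<open>finite A\<close> by (intro open_Int open_INT open_halfspace_Im_gt) auto
    have "closed T" unfolding T_def
      by (intro closed_Int closed_INT closed_halfspace_Im_ge) auto
    have "S \<subseteq> T" by (force simp: S_def T_def)
    then have clS: "closure S \<subseteq> T" using \<open>closed T\<close> by (rule closure_minimal)
    have holF: "F holomorphic_on {z. Im z > 0} - w ` A"
      unfolding F_def E_def
      by (intro holomorphic_intros holomorphic_on_subset[OF hol]) auto
    have TD: "T \<subseteq> {z. Im z > 0} - w ` A" by (force simp: T_def)
    show ?thesis
    proof (rule maximum_modulus_frontier[of F S])
      show "F holomorphic_on interior S"
        using holF interior_subset \<open>S \<subseteq> T\<close> TD by (meson holomorphic_on_subset order_trans)
      show "continuous_on (closure S) F"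
        using holF clS TD by (meson holomorphic_on_imp_continuous_on holomorphic_on_subset order_trans)
      show "bounded S" unfolding S_def by (meson bounded_Int bounded_ball)
      show "\<xi> \<in> S"
      proof -
        have "norm \<xi> < R" by (simp add: \<xi>_def R_def cmod_def real_sqrt_lt_1_iff)
        then show ?thesis using far_\<xi>
          by (auto simp: S_def \<xi>_def dist_norm norm_minus_commute not_le)
      qed
      show "norm (F z) \<le> B" if "z \<in> frontier S" for z
      proof -
        have "z \<in> T" "z \<notin> S"
          using that clS \<open>open S\<close> by (auto simp: frontier_def interior_open)
        then consider "Im z = 1/2" | "norm z = R" | m where "m \<in> A" "norm (z - w m) = 1/4"
          unfolding S_def T_def by (force simp: dist_norm norm_minus_commute)
        then show ?thesis
        proof cases
          case 1
          then have "Re (E z) = 0" by (simp only: ReE) simp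
          then show ?thesis using lt1[of z] 1 \<open>B > 1\<close> by (simp add: normF)
        next
          case 2
          have "Im z > 0" using \<open>z \<in> T\<close> by (auto simp: T_def)
          have "norm (exp (E z)) < B" using R0[of z] 2 by (simp add: R_def)
          then show ?thesis
            using mult_mono[of "norm (g z)" 1 "norm (exp (E z))" B] lt1[OF \<open>Im z > 0\<close>]
            by (simp add: normF)
        next
          case 3
          then show ?thesis using circle[of m z] \<open>z \<in> T\<close> \<open>B > 1\<close> by (auto simp: T_def)
        qed
      qed
    qed
  qed
  have "norm (F \<xi>) \<le> 1" using F_le dense_ge by blast
  moreover have "g \<xi> \<noteq> 0" using nz by (simp add: \<xi>_def)
  ultimately have "exp (ln (norm (g \<xi>)) + Re (E \<xi>)) \<le> 1" by (simp add: normF exp_add)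
  then have "ln (norm (g \<xi>)) \<le> - Re (E \<xi>)" by simp
  moreover have "Re (E \<xi>) \<ge> (\<Sum>x\<in>A. \<delta> / 192)"
    unfolding ReE
  proof (rule sum_mono)
    fix x assume x: "x \<in> A"
    have "(norm (\<xi> - w x))\<^sup>2 = x\<^sup>2 + 1/16"
      unfolding cmod_power2 by (simp add: \<xi>_def w_def power2_eq_square)
    moreover have "\<delta> / 192 \<le> k * x\<^sup>2 * ((1/4) / (x\<^sup>2 + 1/16))"
      using big(1)[OF x] \<open>\<delta> > 0\<close> by (simp add: k_def divide_simps)
    ultimately show "\<delta> / 192 \<le> k * x\<^sup>2 * ((Im \<xi> - 1/2) / (norm (\<xi> - w x))\<^sup>2)"
      by (simp add: \<xi>_def)
  qed
  ultimately show ?thesis by (simp add: \<xi>_def mult.commute)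
qed

section \<open>Growth on the line for functions bounded by one\<close>

lemma sparse_finite_subset:
  fixes X :: "real set"
  assumes "\<And>K. \<exists>x\<in>X. \<bar>x\<bar> \<ge> K"
  shows "\<exists>A\<subseteq>X. finite A \<and> card A = n \<and> (\<forall>x\<in>A. \<bar>x\<bar> \<ge> K) \<and>
    (\<forall>x\<in>A. \<forall>y\<in>A. x \<noteq> y \<longrightarrow> \<bar>x - y\<bar> \<ge> \<bar>x\<bar> / 2 + 1 / 2)"
proof (induction n)
  case 0
  then show ?case by (intro exI[of _ "{}"]) auto
next
  case (Suc n)
  then obtain A where A: "A \<subseteq> X" "finite A" "card A = n" "\<And>x. x \<in> A \<Longrightarrow> \<bar>x\<bar> \<ge> K"
    "\<And>x y. x \<in> A \<Longrightarrow> y \<in> A \<Longrightarrow> x \<noteq> y \<Longrightarrow> \<bar>x - y\<bar> \<ge> \<bar>x\<bar> / 2 + 1 / 2" by blast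
  obtain a where a: "a \<in> X" "\<bar>a\<bar> \<ge> \<bar>K\<bar> + (\<Sum>x\<in>A. 2 * \<bar>x\<bar>) + 1" using assms by blast
  have far: "\<bar>a\<bar> \<ge> 2 * \<bar>x\<bar> + 1" if "x \<in> A" for x
    using a(2) member_le_sum[of x A "\<lambda>x. 2 * \<bar>x\<bar>"] that A(2) by simp
  then have "a \<notin> A" by force
  moreover have "\<bar>a\<bar> \<ge> K"
    using a(2) sum_nonneg[of A "\<lambda>x. 2 * \<bar>x\<bar>"] by simp
  moreover have "\<bar>a - x\<bar> \<ge> \<bar>a\<bar> / 2 + 1 / 2" "\<bar>x - a\<bar> \<ge> \<bar>x\<bar> / 2 + 1 / 2" if "x \<in> A" for x
    using far[OF that] by linarith+
  ultimately show ?case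
    using A a(1) by (intro exI[of _ "insert a A"]) auto
qed

lemma ln_norm_over_square_tendsto_0:
  assumes hol: "g holomorphic_on {z. Im z > 0}"
    and lt1: "\<And>z. Im z > 0 \<Longrightarrow> norm (g z) < 1"
    and nz: "\<And>z. 0 < Im z \<Longrightarrow> Im z < 1 \<Longrightarrow> g z \<noteq> 0"
  shows "((\<lambda>x::real. ln (norm (g (Complex x (1/2)))) / x\<^sup>2) \<longlongrightarrow> 0) at_infinity"
proof (rule ccontr)
  assume "\<not> ?thesis"
  then obtain \<delta> where "\<delta> > 0" and
    \<delta>: "\<not> eventually (\<lambda>x. \<bar>ln (norm (g (Complex x (1/2)))) / x\<^sup>2\<bar> < \<delta>) at_infinity"
    by (auto simp: tendsto_iff dist_norm)
  define X where "X = {x. ln (norm (g (Complex x (1/2)))) \<le> - \<delta> * x\<^sup>2}"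
  have X_unbounded: "\<exists>x\<in>X. \<bar>x\<bar> \<ge> K" for K
  proof -
    obtain x where x: "\<bar>x\<bar> \<ge> max K 1" "\<bar>ln (norm (g (Complex x (1/2)))) / x\<^sup>2\<bar> \<ge> \<delta>"
      using \<delta> unfolding eventually_at_infinity by (metis not_less real_norm_def)
    have "ln (norm (g (Complex x (1/2)))) < 0" using nz lt1 by simp
    moreover have "x\<^sup>2 > 0" using x(1) by auto
    ultimately have "x \<in> X"
      using x(2) by (simp add: X_def abs_divide field_simps)
    then show ?thesis using x(1) by auto
  qed
  define h where "h = - ln (norm (g (Complex 0 (3/4))))"
  obtain n :: nat where n: "h * 192 / \<delta> < real n" using reals_Archimedean2 by blast
  obtain A where A: "A \<subseteq> X" "finite A" "card A = n" "\<And>x. x \<in> A \<Longrightarrow> \<bar>x\<bar> \<ge> real n + 1"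
    "\<And>x y. x \<in> A \<Longrightarrow> y \<in> A \<Longrightarrow> x \<noteq> y \<Longrightarrow> \<bar>x - y\<bar> \<ge> \<bar>x\<bar> / 2 + 1 / 2"
    using sparse_finite_subset[OF X_unbounded, of n "real n + 1"] by blast
  have sq: "x\<^sup>2 \<ge> real n + 1" if "x \<in> A" for x
  proof -
    have "real n + 1 \<le> (real n + 1)\<^sup>2" by (simp add: power2_eq_square algebra_simps)
    also have "\<dots> \<le> \<bar>x\<bar>\<^sup>2" using A(4)[OF that] by (intro power_mono) auto
    finally show ?thesis by simp
  qed
  have "ln (norm (g (Complex 0 (3/4)))) \<le> - (\<delta> * real (card A) / 192)"
  proof (rule ln_norm_le_card_bound[OF hol lt1 nz \<open>finite A\<close> \<open>\<delta> > 0\<close>])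
    show "1 \<le> x\<^sup>2" "real (card A) \<le> x\<^sup>2" if "x \<in> A" for x
      using sq[OF that] by (auto simp: A(3))
  qed (use A in \<open>auto simp: X_def\<close>)
  then show False using n \<open>\<delta> > 0\<close> by (simp add: A(3) h_def field_simps)
qed

section \<open>Functions of exponential type\<close>

theorem proposition2p1:
  fixes f :: "complex \<Rightarrow> complex" and \<alpha> C :: real and M :: nat
  assumes "f holomorphic_on {z. Im z > 0}"
    and "\<alpha> \<ge> 0" and "C > 0"
    and "\<And>z. Im z \<ge> 0 \<Longrightarrow> norm (f z) \<le> C * (1 + norm z) ^ M * exp (\<alpha> * Im z)"
    and "\<And>z. 0 < Im z \<Longrightarrow> Im z < 1 \<Longrightarrow> f z \<noteq> 0"
  shows "((\<lambda>x::real. ln (norm (f (of_real x + \<i> / 2))) / x\<^sup>2) \<longlongrightarrow> 0) at_infinity"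
proof -
  \<comment> \<open>The power \<open>2 ^ M\<close> comes from \<open>1 + \<bar>z\<bar> \<le> 2 \<bar>z + \<i>\<bar>\<close>; the additional factor \<open>2\<close> makes the bound on \<open>g\<close> strict.\<close>
  define B where "B = 2 * C * 2 ^ M"
  have "B > 0" using \<open>C > 0\<close> by (simp add: B_def)
  define g where "g = (\<lambda>z. f z * exp (\<i> * of_real \<alpha> * z) / (of_real B * (z + \<i>) ^ M))"
  have plus_i: "z + \<i> \<noteq> 0" if "Im z > 0" for z
    using that by (auto simp: complex_eq_iff)
  have norm_g: "norm (g z) = norm (f z) * exp (- \<alpha> * Im z) / (B * norm (z + \<i>) ^ M)" for z
    using \<open>B > 0\<close> by (simp add: g_def norm_mult norm_divide norm_power)
  have lt1: "norm (g z) < 1" if "Im z > 0" for z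
  proof -
    have "(1 + norm z)\<^sup>2 \<le> (2 * norm (z + \<i>))\<^sup>2"
    proof -
      have "(norm (z + \<i>))\<^sup>2 \<ge> (norm z)\<^sup>2 + 1"
        using that unfolding cmod_power2 by (simp add: power2_eq_square algebra_simps)
      moreover have "2 * norm z \<le> (norm z)\<^sup>2 + 1"
        using zero_le_power2[of "norm z - 1"] by (simp add: power2_eq_square algebra_simps)
      moreover have "(2 * norm (z + \<i>))\<^sup>2 = 4 * (norm (z + \<i>))\<^sup>2"
        by (simp add: power_mult_distrib)
      moreover have "(1 + norm z)\<^sup>2 = 1 + (norm z)\<^sup>2 + 2 * norm z"
        by (simp add: power2_sum)
      ultimately show ?thesis
        using zero_le_power2[of "norm (z + \<i>)"] by linarith
    qed
    then have "1 + norm z \<le> 2 * norm (z + \<i>)" by (rule power2_le_imp_le) simp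
    then have pow: "(1 + norm z) ^ M \<le> 2 ^ M * norm (z + \<i>) ^ M"
      by (metis norm_ge_zero add_nonneg_nonneg power_mono power_mult_distrib zero_le_one)
    have pos: "B * norm (z + \<i>) ^ M > 0" using \<open>B > 0\<close> plus_i[OF that] by simp
    have "norm (f z) * exp (- \<alpha> * Im z)
        \<le> C * (1 + norm z) ^ M * exp (\<alpha> * Im z) * exp (- \<alpha> * Im z)"
      using assms(4)[of z] that by (intro mult_right_mono) auto
    also have "\<dots> = C * (1 + norm z) ^ M" by (simp add: exp_minus)
    also have "\<dots> \<le> C * (2 ^ M * norm (z + \<i>) ^ M)" using pow \<open>C > 0\<close> by simp
    also have "\<dots> < B * norm (z + \<i>) ^ M" using pos by (simp add: B_def)
    finally show ?thesis using pos by (simp add: norm_g)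
  qed
  have nz: "g z \<noteq> 0" if "0 < Im z" "Im z < 1" for z
    using assms(5)[OF that] plus_i[OF that(1)] \<open>B > 0\<close> by (simp add: g_def)
  have hol: "g holomorphic_on {z. Im z > 0}"
    unfolding g_def using plus_i \<open>B > 0\<close> by (auto intro!: holomorphic_intros assms(1))
  have lim: "((\<lambda>x::real. ln (norm (g (Complex x (1/2)))) / x\<^sup>2) \<longlongrightarrow> 0) at_infinity"
    using hol lt1 nz by (rule ln_norm_over_square_tendsto_0)
  have ln_f: "ln (norm (f (of_real x + \<i> / 2))) / x\<^sup>2 =
      ln (norm (g (Complex x (1/2)))) / x\<^sup>2
      + (\<alpha> / 2 + ln B + M * ln (sqrt (x\<^sup>2 + 9/4))) / x\<^sup>2" for x :: real
  proof -
    define z where "z = Complex x (1/2)"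
    have z: "of_real x + \<i> / 2 = z" by (simp add: z_def complex_eq_iff)
    have fz: "f z \<noteq> 0" using assms(5) by (simp add: z_def)
    have "norm (z + \<i>) = sqrt (x\<^sup>2 + 9/4)"
      by (simp add: z_def cmod_def power2_eq_square)
    moreover have "norm (z + \<i>) > 0" using plus_i[of z] by (simp add: z_def)
    ultimately have "ln (norm (g z)) = ln (norm (f z)) - \<alpha> / 2 - (ln B + M * ln (sqrt (x\<^sup>2 + 9/4)))"
      using fz \<open>B > 0\<close> unfolding norm_g
      by (simp add: ln_div ln_mult ln_realpow z_def)
    then show ?thesis unfolding z by (simp add: z_def add_divide_distrib diff_divide_distrib)
  qed
  have "((\<lambda>x::real. (\<alpha> / 2 + ln B + M * ln (sqrt (x\<^sup>2 + 9/4))) / x\<^sup>2) \<longlongrightarrow> 0) at_infinity"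
    unfolding at_infinity_eq_at_top_bot by (intro filterlim_sup; real_asymp)
  from tendsto_add[OF lim this] show ?thesis by (simp add: ln_f)
qed

end
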